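(* Let $(X,\delta)$ be a diversity with tight span $(T_X,\delta_T)$. For each $x\in X$ let $h_x:\mathcal{P}_{\mathrm{fin}}(X)\to\mathbb{R}$ be $h_x(A)=\delta(A\cup\{x\})$, and let $\kappa$ be the map $x\mapsto h_x$. 1. The map $\kappa$ is an embedding from $(X,\delta)$ into $(T_X,\delta_T)$ (in particular it takes values in $T_X$). 2. For all finite $Y\subseteq X$ and all $f\in T_X$, $\delta_T(\kappa(Y)\cup\{f\})=f(Y)$. 3. If $(T_X,\widehat{\delta})$ is a diversity such that $\widehat{\delta}(\kappa(Y)\cup\{f\})=f(Y)$ for all finite $Y\subseteq X$ and all $f\in T_X$, then $\widehat{\delta}(F)\ge\delta_T(F)$ for all finite $F\subseteq T_X$.
   Context: For a set $X$, $\mathcal{P}_{\mathrm{fin}}(X)$ denotes the set of all finite subsets of $X$. A diversity is a pair $(X,\delta)$ where $X$ is a set and $\delta:\mathcal{P}_{\mathrm{fin}}(X)\to\mathbb{R}$ satisfies, for all finite $A,B,C\subseteq X$: (D1) $\delta(A)\ge 0$, and $\delta(A)=0$ if and only if $|A|\le 1$; (D2) if $B\ne\emptyset$ then $\delta(A\cup C)\le\delta(A\cup B)+\delta(B\cup C)$. Given a diversity $(X,\delta)$, $P_X$ is the set of all functions $f:\mathcal{P}_{\mathrm{fin}}(X)\to\mathbb{R}$ with $f(\emptyset)=0$ and $\sum_{A\in\mathscr{A}}f(A)\ge\delta\big(\bigcup_{A\in\mathscr{A}}A\big)$ for all finite $\mathscr{A}\subseteq\mathcal{P}_{\mathrm{fin}}(X)$.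 Write $f\preceq g$ if $f(A)\le g(A)$ for all finite $A\subseteq X$. The tight span $T_X$ is the set of elements of $P_X$ that are minimal with respect to $\preceq$. The function $\delta_T:\mathcal{P}_{\mathrm{fin}}(T_X)\to\mathbb{R}$ is defined by $\delta_T(\emptyset)=0$ and, for finite non-empty $F\subseteq T_X$, $$\delta_T(F)=\sup\left\{\delta\Big(\bigcup_{A\in\mathscr{A}}A\Big)-\sum_{A\in\mathscr{A}}\inf_{f\in F}f(A):\ \mathscr{A}\subseteq\mathcal{P}_{\mathrm{fin}}(X),\ |\mathscr{A}|<\infty\right\}.$$ The pair $(T_X,\delta_T)$ is a diversity. An embedding from a diversity $(Y_1,\delta_1)$ into a diversity $(Y_2,\delta_2)$ is an injective map $\pi:Y_1\to Y_2$ with $\delta_1(A)=\delta_2(\pi(A))$ for all finite $A\subseteq Y_1$. *)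

theory Defs
  imports Complex_Main "HOL-Library.FuncSet"
begin

locale diversity =
  fixes X :: "'a set" and \<delta> :: "'a set \<Rightarrow> real"
  assumes nonneg: "A \<in> Fpow X \<Longrightarrow> \<delta> A \<ge> 0"
    and eq_0_iff: "A \<in> Fpow X \<Longrightarrow> \<delta> A = 0 \<longleftrightarrow> card A \<le> 1"
    and triangle: "\<lbrakk>A \<in> Fpow X; B \<in> Fpow X; C \<in> Fpow X; B \<noteq> {}\<rbrakk>
      \<Longrightarrow> \<delta> (A \<union> C) \<le> \<delta> (A \<union> B) + \<delta> (B \<union> C)"

text \<open>
  Real functions on the finite subsets of \<open>X\<close> are represented by functions that are
  \<^const>\<open>extensional\<close> on \<open>Fpow X\<close>, so that HOL equality of representatives is equality of
  functions on \<open>Fpow X\<close> and finite sets of such functions have the right cardinality.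
\<close>

definition diversity_P :: "'a set \<Rightarrow> ('a set \<Rightarrow> real) \<Rightarrow> ('a set \<Rightarrow> real) set" where
  "diversity_P X \<delta> =
    {f \<in> extensional (Fpow X).
      f {} = 0 \<and> (\<forall>\<A>\<in>Fpow (Fpow X). (\<Sum>A\<in>\<A>. f A) \<ge> \<delta> (\<Union>\<A>))}"

definition tight_span :: "'a set \<Rightarrow> ('a set \<Rightarrow> real) \<Rightarrow> ('a set \<Rightarrow> real) set" where
  "tight_span X \<delta> =
    {f \<in> diversity_P X \<delta>. \<forall>g\<in>diversity_P X \<delta>. (\<forall>A\<in>Fpow X. g A \<le> f A) \<longrightarrow> g = f}"

definition tight_span_div :: "'a set \<Rightarrow> ('a set \<Rightarrow> real) \<Rightarrow> ('a set \<Rightarrow> real) set \<Rightarrow> real" where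
  "tight_span_div X \<delta> F =
    (if F = {} then 0
     else SUP \<A>\<in>Fpow (Fpow X). \<delta> (\<Union>\<A>) - (\<Sum>A\<in>\<A>. INF f\<in>F. f A))"

definition kappa :: "'a set \<Rightarrow> ('a set \<Rightarrow> real) \<Rightarrow> 'a \<Rightarrow> 'a set \<Rightarrow> real" where
  "kappa X \<delta> x = (\<lambda>A\<in>Fpow X. \<delta> (A \<union> {x}))"

definition diversity_embedding ::
  "'a set \<Rightarrow> ('a set \<Rightarrow> real) \<Rightarrow> 'b set \<Rightarrow> ('b set \<Rightarrow> real) \<Rightarrow> ('a \<Rightarrow> 'b) \<Rightarrow> bool" where
  "diversity_embedding Y\<^sub>1 \<delta>\<^sub>1 Y\<^sub>2 \<delta>\<^sub>2 \<pi> \<longleftrightarrow>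
    diversity Y\<^sub>1 \<delta>\<^sub>1 \<and> diversity Y\<^sub>2 \<delta>\<^sub>2 \<and>
    \<pi> ` Y\<^sub>1 \<subseteq> Y\<^sub>2 \<and> inj_on \<pi> Y\<^sub>1 \<and> (\<forall>A\<in>Fpow Y\<^sub>1. \<delta>\<^sub>1 A = \<delta>\<^sub>2 (\<pi> ` A))"

end

theory Submission
  imports Defs
begin

text \<open>
  Write \<open>T\<close> for the tight span.  Expanding each infimum in the definition of \<open>\<delta>\<^sub>T\<close> into a choice
  of a function that attains it turns \<open>\<delta>\<^sub>T(F)\<close> into the supremum of
  \<open>\<delta>(\<Union>A\<^sub>i) - \<Sum>f\<^sub>i(A\<^sub>i)\<close> over the finite sets of pairs \<open>(f\<^sub>i, A\<^sub>i) \<in> F \<times> Fpow X\<close>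
  (\<open>tight_span_div_lower\<close> and \<open>tight_span_div_upper\<close>), for nonempty \<open>F\<close>.  In this form a lower
  bound on \<open>\<delta>\<^sub>T\<close> needs only one set of pairs, and such sets can be united freely: values are
  nonnegative, so a pair that occurs in both only makes the union cheaper.

  Minimality of \<open>f \<in> T\<close> says that no value \<open>f(A)\<close> can be lowered, so \<open>f(A)\<close> is approximated
  by \<open>\<delta>(A \<union> \<Union>\<C>) - \<Sum>\<^bsub>C\<in>\<C>\<^esub> f(C)\<close> (\<open>tight_span_approx\<close>).
  Appending such a \<open>\<C>\<close>, paired with \<open>f\<close>, to a set of pairs with union \<open>P\<close> shows that
  \<open>f(P) - \<Sum>f\<^sub>i(A\<^sub>i) \<le> \<delta>\<^sub>T(F \<union> {f})\<close> (\<open>tight_span_div_insert_lower\<close>).  This estimate does most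
  of the work:

  \<^item> For the triangle inequality through \<open>g \<in> G\<close>, a set of pairs over \<open>F \<union> H\<close> splits into one
    over \<open>F\<close> with union \<open>P\<close> and one over \<open>H\<close> with union \<open>Q\<close>, and \<open>\<delta>(P \<union> Q) \<le> g(P) + g(Q)\<close>.

  \<^item> The pairs \<open>(\<kappa>(y), {y})\<close> for \<open>y \<in> Y\<close> have union \<open>Y\<close> and cost \<open>0\<close>, which gives
    \<open>f(Y) \<le> \<delta>\<^sub>T(\<kappa>(Y) \<union> {f})\<close>.  For the converse, a pair \<open>(\<kappa>(y), A)\<close> costs
    \<open>\<delta>(A \<union> {y})\<close>, exactly the price of joining \<open>A\<close> to a set that contains \<open>y\<close>.

  That \<open>\<kappa>\<close> preserves diversities is the case \<open>f = \<kappa>(y)\<close> with \<open>y \<in> Y\<close>.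
  Finally, if \<open>\<delta>'\<close> satisfies the same identity, then \<open>f(A) = \<delta>'(\<kappa>(A) \<union> {f})\<close> is the price
  of joining \<open>\<kappa>(A)\<close> to a set that contains \<open>f\<close>; joining all the \<open>\<kappa>(A\<^sub>i)\<close> to \<open>F\<close> gives
  \<open>\<delta>(\<Union>A\<^sub>i) \<le> \<delta>'(F) + \<Sum>f\<^sub>i(A\<^sub>i)\<close>, whence \<open>\<delta>\<^sub>T \<le> \<delta>'\<close>.
\<close>

text \<open>
  A finite set of pairs records which function is charged for each set.  A set in place of an
  indexed family suffices because a repeated pair would add to the cost but not to the cover.
\<close>

definition cover :: "(('a set \<Rightarrow> real) \<times> 'a set) set \<Rightarrow> 'a set" where
  "cover S = (\<Union>p\<in>S. snd p)"

definition cost :: "(('a set \<Rightarrow> real) \<times> 'a set) set \<Rightarrow> real" where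
  "cost S = (\<Sum>p\<in>S. fst p (snd p))"

lemma cover_simps [simp]:
  "cover {} = {}"
  "cover (insert p S) = snd p \<union> cover S"
  "cover (S \<union> S') = cover S \<union> cover S'"
  by (auto simp: cover_def)

lemma cost_empty [simp]: "cost {} = 0"
  by (simp add: cost_def)

lemma cost_insert: "finite S \<Longrightarrow> p \<notin> S \<Longrightarrow> cost (insert p S) = fst p (snd p) + cost S"
  by (simp add: cost_def)

lemma cover_Pair_image: "cover (Pair f ` \<A>) = \<Union>\<A>"
  by (auto simp: cover_def)

lemma cost_Pair_image: "cost (Pair f ` \<A>) = (\<Sum>A\<in>\<A>. f A)"
  by (simp add: cost_def sum.reindex inj_on_def)

lemma cover_in_Fpow: "S \<in> Fpow (F \<times> Fpow X) \<Longrightarrow> cover S \<in> Fpow X"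
  by (fastforce simp: cover_def Fpow_def)

lemma snd_image_in_Fpow: "S \<in> Fpow (F \<times> B) \<Longrightarrow> snd ` S \<in> Fpow B"
  by (auto simp: Fpow_def)

lemma Union_in_Fpow: "\<A> \<in> Fpow (Fpow X) \<Longrightarrow> \<Union>\<A> \<in> Fpow X"
  by (auto simp: Fpow_def)

lemma Un_in_Fpow: "A \<in> Fpow X \<Longrightarrow> B \<in> Fpow X \<Longrightarrow> A \<union> B \<in> Fpow X"
  by (auto simp: Fpow_def)

lemma insert_in_Fpow: "x \<in> X \<Longrightarrow> A \<in> Fpow X \<Longrightarrow> insert x A \<in> Fpow X"
  by (auto simp: Fpow_def)

context diversity
begin

section \<open>Diversities\<close>

lemma empty_eq_0: "\<delta> {} = 0"
  using eq_0_iff[of "{}"] by (simp add: empty_in_Fpow)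

lemma singleton_eq_0: "x \<in> X \<Longrightarrow> \<delta> {x} = 0"
  using eq_0_iff[of "{x}"] by (simp add: insert_in_Fpow empty_in_Fpow)

lemma insert_mono:
  assumes "A \<in> Fpow X" "x \<in> X"
  shows "\<delta> A \<le> \<delta> (insert x A)"
  using triangle[of A "{x}" "{}"] assms singleton_eq_0
  by (simp add: insert_in_Fpow empty_in_Fpow)

text \<open>
  Elements have to be added one at a time: the triangle inequality through \<open>B\<close> alone gives only
  \<open>\<delta> A \<le> \<delta> (A \<union> B) + \<delta> B\<close>, and the last term vanishes for singletons.
\<close>

lemma mono_Un:
  assumes "A \<in> Fpow X" "B \<in> Fpow X"
  shows "\<delta> A \<le> \<delta> (A \<union> B)"
proof -
  have "finite B" "B \<subseteq> X" using assms by (auto simp: Fpow_def)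
  then show ?thesis
  proof (induction B rule: finite_induct)
    case (insert x B)
    have "A \<union> B \<in> Fpow X" using insert assms by (auto simp: Fpow_def)
    then show ?case using insert insert_mono[of "A \<union> B" x] by auto
  qed simp
qed

lemma mono: "A \<subseteq> B \<Longrightarrow> B \<in> Fpow X \<Longrightarrow> \<delta> A \<le> \<delta> B"
  using mono_Un[of A B] by (auto simp: Fpow_def Un_absorb1 dest: finite_subset)

lemma join:
  assumes "A \<in> Fpow X" "C \<in> Fpow X" "x \<in> X"
  shows "\<delta> (insert x (A \<union> C)) \<le> \<delta> (insert x A) + \<delta> (insert x C)"
  using triangle[of "insert x A" "{x}" C] assms by (simp add: insert_in_Fpow empty_in_Fpow)

section \<open>The tight span\<close>

lemma diversity_P_empty: "f \<in> diversity_P X \<delta> \<Longrightarrow> f {} = 0"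
  by (simp add: diversity_P_def)

lemma diversity_P_Union:
  "f \<in> diversity_P X \<delta> \<Longrightarrow> \<A> \<in> Fpow (Fpow X) \<Longrightarrow> \<delta> (\<Union>\<A>) \<le> (\<Sum>A\<in>\<A>. f A)"
  by (simp add: diversity_P_def)

lemma diversity_P_ge: "f \<in> diversity_P X \<delta> \<Longrightarrow> A \<in> Fpow X \<Longrightarrow> \<delta> A \<le> f A"
  using diversity_P_Union[of f "{A}"] by (simp add: insert_in_Fpow empty_in_Fpow)

lemma diversity_P_nonneg: "f \<in> diversity_P X \<delta> \<Longrightarrow> A \<in> Fpow X \<Longrightarrow> 0 \<le> f A"
  using diversity_P_ge nonneg by (meson order_trans)

lemma diversity_P_Un_Union:
  assumes f: "f \<in> diversity_P X \<delta>" and A: "A \<in> Fpow X" and "\<A> \<in> Fpow (Fpow X)"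
  shows "\<delta> (A \<union> \<Union>\<A>) \<le> f A + (\<Sum>B\<in>\<A>. f B)"
proof -
  have "\<delta> (\<Union>(insert A \<A>)) \<le> (\<Sum>B\<in>insert A \<A>. f B)"
    using assms by (intro diversity_P_Union) (auto simp: Fpow_def)
  also have "\<dots> \<le> f A + (\<Sum>B\<in>\<A>. f B)"
    using assms diversity_P_nonneg[OF f A] by (cases "A \<in> \<A>") (auto simp: Fpow_def insert_absorb)
  finally show ?thesis by simp
qed

lemma diversity_P_Un:
  "f \<in> diversity_P X \<delta> \<Longrightarrow> A \<in> Fpow X \<Longrightarrow> B \<in> Fpow X \<Longrightarrow> \<delta> (A \<union> B) \<le> f A + f B"
  using diversity_P_Un_Union[of f A "{B}"] by (simp add: insert_in_Fpow empty_in_Fpow)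

lemma tight_span_in_P: "f \<in> tight_span X \<delta> \<Longrightarrow> f \<in> diversity_P X \<delta>"
  by (simp add: tight_span_def)

text \<open>
  If no \<open>\<C>\<close> came within \<open>e\<close> of \<open>f A\<close>, then lowering the single value \<open>f A\<close> by \<open>e\<close> would keep
  every inequality that defines membership in \<^const>\<open>diversity_P\<close>, against minimality.
\<close>

lemma tight_span_approx:
  assumes f: "f \<in> tight_span X \<delta>" and A: "A \<in> Fpow X" and e: "e > 0"
  shows "\<exists>\<C>\<in>Fpow (Fpow X). f A - e < \<delta> (A \<union> \<Union>\<C>) - (\<Sum>C\<in>\<C>. f C)"
proof (cases "A = {}")
  \<comment> \<open>The value at the empty set is pinned to \<open>0\<close> and cannot be lowered.\<close>
  case True
  show ?thesis
    using True e diversity_P_empty[OF tight_span_in_P[OF f]] empty_eq_0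
    by (intro bexI[of _ "{}"]) (simp_all add: empty_in_Fpow)
next
  case False
  show ?thesis
  proof (rule ccontr)
    assume neg: "\<not> ?thesis"
    have low: "\<delta> (A \<union> \<Union>\<C>) \<le> (f A - e) + (\<Sum>C\<in>\<C>. f C)" if "\<C> \<in> Fpow (Fpow X)" for \<C>
      using neg that by force
    define g where "g = f(A := f A - e)"
    have fP: "f \<in> diversity_P X \<delta>" using f by (rule tight_span_in_P)
    have "g \<in> diversity_P X \<delta>"
      unfolding diversity_P_def
    proof (safe)
      show "g \<in> extensional (Fpow X)"
        using fP A by (auto simp: g_def diversity_P_def extensional_def)
      show "g {} = 0" using False diversity_P_empty[OF fP] by (simp add: g_def)
      fix \<A> assume \<A>: "\<A> \<in> Fpow (Fpow X)"
      show "\<delta> (\<Union>\<A>) \<le> sum g \<A>"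
      proof (cases "A \<in> \<A>")
        case True
        have fin: "finite \<A>" using \<A> by (simp add: Fpow_def)
        have "\<A> - {A} \<in> Fpow (Fpow X)" using \<A> by (auto simp: Fpow_def)
        then have "\<delta> (A \<union> \<Union>(\<A> - {A})) \<le> (f A - e) + (\<Sum>C\<in>\<A> - {A}. f C)" by (rule low)
        also have "A \<union> \<Union>(\<A> - {A}) = \<Union>\<A>" using True by auto
        also have "(\<Sum>C\<in>\<A> - {A}. f C) = sum g (\<A> - {A})"
          by (intro sum.cong) (auto simp: g_def)
        also have "(f A - e) + sum g (\<A> - {A}) = sum g \<A>"
          using sum.remove[OF fin True, of g] by (simp add: g_def)
        finally show ?thesis .
      next
        case False
        then have "sum g \<A> = sum f \<A>" by (intro sum.cong) (auto simp: g_def)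
        then show ?thesis using diversity_P_Union[OF fP \<A>] by simp
      qed
    qed
    moreover have "\<forall>B\<in>Fpow X. g B \<le> f B" using e by (simp add: g_def)
    ultimately have "g = f" using f by (auto simp: tight_span_def)
    then show False using e by (auto simp: g_def dest: fun_cong[of _ _ A])
  qed
qed

lemma cost_nonneg:
  assumes "F \<subseteq> tight_span X \<delta>" "S \<in> Fpow (F \<times> Fpow X)"
  shows "0 \<le> cost S"
  unfolding cost_def using assms
  by (intro sum_nonneg) (auto simp: Fpow_def intro!: diversity_P_nonneg tight_span_in_P)

lemma cost_Un:
  assumes "F \<subseteq> tight_span X \<delta>" "S \<in> Fpow (F \<times> Fpow X)" "S' \<in> Fpow (F \<times> Fpow X)"
  shows "cost (S \<union> S') \<le> cost S + cost S'"
proof -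
  have "S \<inter> S' \<in> Fpow (F \<times> Fpow X)" using assms by (auto simp: Fpow_def)
  from cost_nonneg[OF assms(1) this] have "0 \<le> cost (S \<inter> S')" .
  then show ?thesis
    using assms sum.union_inter[of S S' "\<lambda>p. fst p (snd p)"] by (simp add: cost_def Fpow_def)
qed

section \<open>The diversity on the tight span\<close>

lemma Inf_as_cost:
  assumes F: "F \<in> Fpow (tight_span X \<delta>)" "F \<noteq> {}" and \<A>: "\<A> \<in> Fpow (Fpow X)"
  obtains S where "S \<in> Fpow (F \<times> Fpow X)" "cover S = \<Union>\<A>" "cost S = (\<Sum>A\<in>\<A>. INF f\<in>F. f A)"
proof -
  have fin: "finite F" using F by (simp add: Fpow_def)
  have "\<exists>f. f \<in> F \<and> f A = (INF f\<in>F. f A)" for A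
  proof -
    have "(INF f\<in>F. f A) \<in> (\<lambda>f. f A) ` F"
      using Min_in[of "(\<lambda>f. f A) ` F"] fin F(2) by (simp add: cInf_eq_Min)
    then obtain f where "(INF f\<in>F. f A) = f A" "f \<in> F" by (rule imageE)
    then show ?thesis by (intro exI[of _ f] conjI) (simp_all only:)
  qed
  then have "\<exists>\<phi>. \<forall>A. \<phi> A \<in> F \<and> \<phi> A A = (INF f\<in>F. f A)" by (intro choice) blast
  then obtain \<phi> where \<phi>: "\<And>A. \<phi> A \<in> F" "\<And>A. \<phi> A A = (INF f\<in>F. f A)" by blast
  show ?thesis
  proof
    show "(\<lambda>A. (\<phi> A, A)) ` \<A> \<in> Fpow (F \<times> Fpow X)" using \<phi> \<A> by (auto simp: Fpow_def)
    show "cover ((\<lambda>A. (\<phi> A, A)) ` \<A>) = \<Union>\<A>" by (auto simp: cover_def)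
    show "cost ((\<lambda>A. (\<phi> A, A)) ` \<A>) = (\<Sum>A\<in>\<A>. INF f\<in>F. f A)"
      by (simp add: cost_def sum.reindex inj_on_def \<phi>)
  qed
qed

lemma tight_span_div_upper:
  assumes F: "F \<in> Fpow (tight_span X \<delta>)" "F \<noteq> {}"
    and u: "\<And>S. S \<in> Fpow (F \<times> Fpow X) \<Longrightarrow> \<delta> (cover S) \<le> u + cost S"
  shows "tight_span_div X \<delta> F \<le> u"
proof -
  have "\<delta> (\<Union>\<A>) - (\<Sum>A\<in>\<A>. INF f\<in>F. f A) \<le> u" if \<A>: "\<A> \<in> Fpow (Fpow X)" for \<A>
  proof -
    obtain S where "S \<in> Fpow (F \<times> Fpow X)" "cover S = \<Union>\<A>"
        "cost S = (\<Sum>A\<in>\<A>. INF f\<in>F. f A)"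
      by (rule Inf_as_cost[OF F \<A>])
    then show ?thesis using u[of S] by simp
  qed
  moreover have "Fpow (Fpow X) \<noteq> {}" using empty_in_Fpow by blast
  ultimately have "(SUP \<A>\<in>Fpow (Fpow X). \<delta> (\<Union>\<A>) - (\<Sum>A\<in>\<A>. INF f\<in>F. f A)) \<le> u"
    by (intro cSUP_least)
  then show ?thesis using F by (simp add: tight_span_div_def)
qed

text \<open>
  The supremum that defines \<^const>\<open>tight_span_div\<close> is finite because all unions can be tied
  together at one point \<open>x\<close>: attaching the sets paired with \<open>f\<close> to \<open>x\<close> costs at most \<open>f {x}\<close> in
  addition to the values of \<open>f\<close> that are subtracted anyway.
\<close>

lemma cover_bound:
  assumes x: "x \<in> X" and "finite F" "F \<subseteq> tight_span X \<delta>" "S \<in> Fpow (F \<times> Fpow X)"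
  shows "\<delta> (insert x (cover S)) \<le> (\<Sum>f\<in>F. f {x}) + cost S"
  using assms(2-)
proof (induction F arbitrary: S rule: finite_induct)
  case empty
  then have "S = {}" by (auto simp: Fpow_def)
  then show ?case using singleton_eq_0[OF x] by simp
next
  case (insert g F)
  define \<A> where "\<A> = {A. (g, A) \<in> S}"
  define S' where "S' = S - Pair g ` \<A>"
  have S: "S = Pair g ` \<A> \<union> S'" by (auto simp: \<A>_def S'_def)
  have "\<A> \<subseteq> snd ` S" by (force simp: \<A>_def)
  moreover have "finite S" using insert.prems by (simp add: Fpow_def)
  ultimately have "finite \<A>" by (metis finite_imageI finite_subset)
  then have \<A>: "\<A> \<in> Fpow (Fpow X)" using insert.prems by (auto simp: Fpow_def \<A>_def)
  have S': "S' \<in> Fpow (F \<times> Fpow X)" using insert.prems by (auto simp: Fpow_def \<A>_def S'_def)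
  have x1: "{x} \<in> Fpow X" using x by (simp add: Fpow_def)
  have g: "g \<in> diversity_P X \<delta>" using insert.prems tight_span_in_P by auto
  have "\<delta> (insert x (cover S)) = \<delta> (insert x (\<Union>\<A> \<union> cover S'))"
    by (subst S) (simp add: cover_Pair_image)
  also have "\<dots> \<le> \<delta> (insert x (\<Union>\<A>)) + \<delta> (insert x (cover S'))"
    using x \<A> S' by (intro join Union_in_Fpow cover_in_Fpow)
  also have "\<dots> \<le> (g {x} + (\<Sum>A\<in>\<A>. g A)) + ((\<Sum>f\<in>F. f {x}) + cost S')"
    using diversity_P_Un_Union[OF g x1 \<A>] insert.IH[OF _ S'] insert.prems by simp
  also have "(\<Sum>A\<in>\<A>. g A) + cost S' = cost S"
  proof -
    have "cost S = cost (Pair g ` \<A>) + cost S'"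
      unfolding cost_def using \<open>finite S\<close> \<open>finite \<A>\<close>
      by (subst S, subst sum.union_disjoint) (auto simp: S'_def)
    then show ?thesis by (simp add: cost_Pair_image)
  qed
  then have "(g {x} + (\<Sum>A\<in>\<A>. g A)) + ((\<Sum>f\<in>F. f {x}) + cost S')
      = (\<Sum>f\<in>insert g F. f {x}) + cost S"
    using insert.hyps by simp
  finally show ?case .
qed

lemma tight_span_div_bdd_above:
  assumes F: "F \<in> Fpow (tight_span X \<delta>)" "F \<noteq> {}"
  shows "bdd_above ((\<lambda>\<A>. \<delta> (\<Union>\<A>) - (\<Sum>A\<in>\<A>. INF f\<in>F. f A)) ` Fpow (Fpow X))"
proof -
  have F': "finite F" "F \<subseteq> tight_span X \<delta>" using F by (auto simp: Fpow_def)
  obtain u where u: "\<And>S. S \<in> Fpow (F \<times> Fpow X) \<Longrightarrow> \<delta> (cover S) \<le> u + cost S"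
  proof (cases "X = {}")
    case True
    show ?thesis
    proof (rule that[of 0])
      fix S assume S: "S \<in> Fpow (F \<times> Fpow X)"
      have "cover S = {}" using cover_in_Fpow[OF S] True by (auto simp: Fpow_def)
      then show "\<delta> (cover S) \<le> 0 + cost S" using cost_nonneg[OF F'(2) S] empty_eq_0 by simp
    qed
  next
    case False
    then obtain x where x: "x \<in> X" by auto
    show ?thesis
    proof (rule that)
      fix S assume S: "S \<in> Fpow (F \<times> Fpow X)"
      show "\<delta> (cover S) \<le> (\<Sum>f\<in>F. f {x}) + cost S"
        using insert_mono[OF cover_in_Fpow[OF S] x] cover_bound[OF x F' S] by simp
    qed
  qed
  show ?thesis
  proof (rule bdd_aboveI2)
    fix \<A> assume \<A>: "\<A> \<in> Fpow (Fpow X)"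
    obtain S where "S \<in> Fpow (F \<times> Fpow X)" "cover S = \<Union>\<A>"
        "cost S = (\<Sum>A\<in>\<A>. INF f\<in>F. f A)"
      by (rule Inf_as_cost[OF F \<A>])
    then show "\<delta> (\<Union>\<A>) - (\<Sum>A\<in>\<A>. INF f\<in>F. f A) \<le> u" using u[of S] by simp
  qed
qed

lemma tight_span_div_lower:
  assumes F: "F \<in> Fpow (tight_span X \<delta>)" "F \<noteq> {}" and S: "S \<in> Fpow (F \<times> Fpow X)"
  shows "\<delta> (cover S) - cost S \<le> tight_span_div X \<delta> F"
proof -
  let ?m = "\<lambda>A. INF f\<in>F. f A"
  have finF: "finite F" and FT: "F \<subseteq> tight_span X \<delta>" using F by (auto simp: Fpow_def)
  have finS: "finite S" and SF: "\<And>f A. (f, A) \<in> S \<Longrightarrow> f \<in> F \<and> A \<in> Fpow X"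
    using S by (auto simp: Fpow_def)
  have m0: "0 \<le> ?m A" if "A \<in> Fpow X" for A
    using F(2) FT that by (intro cINF_greatest) (auto intro!: diversity_P_nonneg tight_span_in_P)
  have "(\<Sum>A\<in>snd ` S. ?m A) \<le> (\<Sum>p\<in>S. (?m \<circ> snd) p)"
    using finS SF m0 by (intro sum_image_le[unfolded comp_def[symmetric]]) auto
  also have "\<dots> \<le> cost S"
    unfolding cost_def using SF finF
    by (intro sum_mono) (auto intro!: cINF_lower bdd_below_finite)
  finally have "\<delta> (cover S) - cost S \<le> \<delta> (\<Union>(snd ` S)) - (\<Sum>A\<in>snd ` S. ?m A)"
    by (simp add: cover_def)
  also have "\<dots> \<le> (SUP \<A>\<in>Fpow (Fpow X). \<delta> (\<Union>\<A>) - (\<Sum>A\<in>\<A>. ?m A))"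
    by (intro cSUP_upper tight_span_div_bdd_above F snd_image_in_Fpow[OF S])
  finally show ?thesis using F(2) by (simp add: tight_span_div_def)
qed

text \<open>
  A family \<open>\<C>\<close> that approximates \<open>g (cover S)\<close> enlarges \<open>S\<close> to \<open>S \<union> {g} \<times> \<C>\<close>, a set of pairs
  over \<open>insert g F\<close>.  Since \<open>\<delta>\<close> of a cover thereby becomes a value of \<open>g\<close>, this is the tool for
  bounding \<open>tight_span_div\<close> from below.
\<close>

lemma tight_span_div_insert_lower:
  assumes F: "F \<in> Fpow (tight_span X \<delta>)" and g: "g \<in> tight_span X \<delta>"
    and S: "S \<in> Fpow (F \<times> Fpow X)"
  shows "g (cover S) - cost S \<le> tight_span_div X \<delta> (insert g F)"
proof (rule field_le_epsilon)
  fix e :: real assume "e > 0"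
  then obtain \<C> where \<C>: "\<C> \<in> Fpow (Fpow X)"
      "g (cover S) - e < \<delta> (cover S \<union> \<Union>\<C>) - (\<Sum>C\<in>\<C>. g C)"
    using tight_span_approx[OF g cover_in_Fpow[OF S]] by blast
  have F': "insert g F \<in> Fpow (tight_span X \<delta>)" using F g by (auto simp: Fpow_def)
  then have F'': "insert g F \<subseteq> tight_span X \<delta>" by (simp add: Fpow_def)
  have S1: "S \<in> Fpow (insert g F \<times> Fpow X)" using S by (auto simp: Fpow_def)
  have S2: "Pair g ` \<C> \<in> Fpow (insert g F \<times> Fpow X)" using \<C> by (auto simp: Fpow_def)
  have "\<delta> (cover S \<union> \<Union>\<C>) - cost (S \<union> Pair g ` \<C>) \<le> tight_span_div X \<delta> (insert g F)"
    using tight_span_div_lower[OF F' _ Un_in_Fpow[OF S1 S2]] by (simp add: cover_Pair_image)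
  moreover have "cost (S \<union> Pair g ` \<C>) \<le> cost S + (\<Sum>C\<in>\<C>. g C)"
    using cost_Un[OF F'' S1 S2] by (simp add: cost_Pair_image)
  ultimately show "g (cover S) - cost S \<le> tight_span_div X \<delta> (insert g F) + e"
    using \<C>(2) by linarith
qed

lemma tight_span_div_nonneg:
  assumes "F \<in> Fpow (tight_span X \<delta>)"
  shows "0 \<le> tight_span_div X \<delta> F"
  using tight_span_div_lower[OF assms, of "{}"] empty_eq_0
  by (cases "F = {}") (auto simp: tight_span_div_def empty_in_Fpow)

lemma tight_span_div_mono:
  assumes G: "G \<in> Fpow (tight_span X \<delta>)" and "F \<subseteq> G"
  shows "tight_span_div X \<delta> F \<le> tight_span_div X \<delta> G"
proof (cases "F = {}")
  case True
  then show ?thesis using tight_span_div_nonneg[OF G] by (simp add: tight_span_div_def)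
next
  case False
  show ?thesis
  proof (rule tight_span_div_upper)
    show "F \<in> Fpow (tight_span X \<delta>)"
      using assms by (auto simp: Fpow_def intro: finite_subset)
    show "F \<noteq> {}" by fact
    fix S assume "S \<in> Fpow (F \<times> Fpow X)"
    then have "S \<in> Fpow (G \<times> Fpow X)" using assms(2) by (auto simp: Fpow_def)
    then show "\<delta> (cover S) \<le> tight_span_div X \<delta> G + cost S"
      using tight_span_div_lower[OF G] False assms(2) by force
  qed
qed

lemma tight_span_div_singleton:
  assumes f: "f \<in> tight_span X \<delta>"
  shows "tight_span_div X \<delta> {f} = 0"
proof (rule antisym)
  have F: "{f} \<in> Fpow (tight_span X \<delta>)" using f by (simp add: Fpow_def)
  show "0 \<le> tight_span_div X \<delta> {f}" by (rule tight_span_div_nonneg[OF F])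
  show "tight_span_div X \<delta> {f} \<le> 0"
  proof (rule tight_span_div_upper[OF F])
    fix S assume S: "S \<in> Fpow ({f} \<times> Fpow X)"
    define \<A> where "\<A> = snd ` S"
    have "Pair f ` \<A> = (\<lambda>p. p) ` S"
      unfolding \<A>_def image_image using S by (intro image_cong) (auto simp: Fpow_def)
    then have "S = Pair f ` \<A>" by simp
    then have "cover S = \<Union>\<A>" "cost S = (\<Sum>A\<in>\<A>. f A)"
      by (simp_all add: cover_Pair_image cost_Pair_image)
    moreover have "\<A> \<in> Fpow (Fpow X)" unfolding \<A>_def by (rule snd_image_in_Fpow[OF S])
    ultimately show "\<delta> (cover S) \<le> 0 + cost S"
      using diversity_P_Union[OF tight_span_in_P[OF f]] by simp
  qed simp
qed

text \<open>
  Distinct minimal functions cannot be comparable, so \<open>g A < f A\<close> for some \<open>A\<close>; the single pair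
  \<open>(g, A)\<close> then witnesses that \<open>f A - g A > 0\<close> is a lower bound.
\<close>

lemma tight_span_div_pos:
  assumes F: "F \<in> Fpow (tight_span X \<delta>)" and fg: "f \<in> F" "g \<in> F" "f \<noteq> g"
  shows "0 < tight_span_div X \<delta> F"
proof -
  have T: "f \<in> tight_span X \<delta>" "g \<in> tight_span X \<delta>" using F fg by (auto simp: Fpow_def)
  then obtain A where A: "A \<in> Fpow X" "g A < f A"
    using fg(3) unfolding tight_span_def by (auto simp: not_le) (meson linorder_not_le)
  have "{(g, A)} \<in> Fpow (F \<times> Fpow X)" using A fg by (simp add: Fpow_def)
  from tight_span_div_insert_lower[OF F T(1) this]
  have "f A - g A \<le> tight_span_div X \<delta> F" using fg(1) by (simp add: cost_def insert_absorb)
  then show ?thesis using A by simp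
qed

text \<open>
  Monotonicity reduces \<open>G\<close> to a single \<open>g\<close>, and then \<open>g\<close> mediates between the two halves by
  \<open>\<delta> (P \<union> Q) \<le> g P + g Q\<close>.
\<close>

lemma tight_span_div_triangle:
  assumes F: "F \<in> Fpow (tight_span X \<delta>)" and G: "G \<in> Fpow (tight_span X \<delta>)"
    and H: "H \<in> Fpow (tight_span X \<delta>)" and "G \<noteq> {}"
  shows "tight_span_div X \<delta> (F \<union> H) \<le> tight_span_div X \<delta> (F \<union> G) + tight_span_div X \<delta> (G \<union> H)"
proof -
  obtain g where gG: "g \<in> G" using \<open>G \<noteq> {}\<close> by auto
  have g: "g \<in> tight_span X \<delta>" using G gG by (auto simp: Fpow_def)
  have FG: "tight_span_div X \<delta> (insert g F) \<le> tight_span_div X \<delta> (F \<union> G)"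
    using gG by (intro tight_span_div_mono Un_in_Fpow F G) auto
  have GH: "tight_span_div X \<delta> (insert g H) \<le> tight_span_div X \<delta> (G \<union> H)"
    using gG by (intro tight_span_div_mono Un_in_Fpow G H) auto
  show ?thesis
  proof (cases "F \<union> H = {}")
    case True
    then show ?thesis using tight_span_div_nonneg[OF G] by (simp add: tight_span_div_def)
  next
    case False
    show ?thesis
    proof (rule tight_span_div_upper[OF Un_in_Fpow[OF F H] False])
      fix S assume S: "S \<in> Fpow ((F \<union> H) \<times> Fpow X)"
      \<comment> \<open>Pairs whose function lies in both \<open>F\<close> and \<open>H\<close> are assigned to \<open>F\<close>.\<close>
      define S1 where "S1 = {p \<in> S. fst p \<in> F}"
      define S2 where "S2 = {p \<in> S. fst p \<notin> F}"
      have S_eq: "S = S1 \<union> S2" by (auto simp: S1_def S2_def)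
      have S1: "S1 \<in> Fpow (F \<times> Fpow X)" and S2: "S2 \<in> Fpow (H \<times> Fpow X)"
        using S by (auto simp: Fpow_def S1_def S2_def)
      have "cost S = cost S1 + cost S2"
        unfolding cost_def using S
        by (subst S_eq, subst sum.union_disjoint) (auto simp: S1_def S2_def Fpow_def)
      moreover have "\<delta> (cover S) \<le> g (cover S1) + g (cover S2)"
        unfolding S_eq cover_simps using g S1 S2
        by (intro diversity_P_Un tight_span_in_P cover_in_Fpow)
      ultimately show "\<delta> (cover S) \<le>
          tight_span_div X \<delta> (F \<union> G) + tight_span_div X \<delta> (G \<union> H) + cost S"
        using tight_span_div_insert_lower[OF F g S1] tight_span_div_insert_lower[OF H g S2] FG GH
        by linarith
    qed
  qed
qed

theorem diversity_tight_span: "diversity (tight_span X \<delta>) (tight_span_div X \<delta>)"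
proof
  fix F assume F: "F \<in> Fpow (tight_span X \<delta>)"
  show "0 \<le> tight_span_div X \<delta> F" by (rule tight_span_div_nonneg[OF F])
  have fin: "finite F" using F by (simp add: Fpow_def)
  show "tight_span_div X \<delta> F = 0 \<longleftrightarrow> card F \<le> 1"
  proof
    assume "card F \<le> 1"
    then consider "F = {}" | f where "F = {f}"
      using fin by (metis card_0_eq card_1_singletonE le_eq_less_or_eq less_one)
    then show "tight_span_div X \<delta> F = 0"
      using F tight_span_div_singleton by cases (auto simp: tight_span_div_def Fpow_def)
  next
    assume "tight_span_div X \<delta> F = 0"
    then have "\<forall>f\<in>F. \<forall>g\<in>F. f = g" using tight_span_div_pos[OF F] by force
    then show "card F \<le> 1" using fin by (simp add: card_le_Suc0_iff_eq)
  qed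
qed (rule tight_span_div_triangle)

section \<open>The canonical embedding\<close>

lemma kappa_apply: "A \<in> Fpow X \<Longrightarrow> kappa X \<delta> x A = \<delta> (insert x A)"
  by (simp add: kappa_def)

lemma kappa_in_diversity_P:
  assumes x: "x \<in> X"
  shows "kappa X \<delta> x \<in> diversity_P X \<delta>"
  unfolding diversity_P_def
proof safe
  show "kappa X \<delta> x \<in> extensional (Fpow X)" by (simp add: kappa_def)
  show "kappa X \<delta> x {} = 0" using x by (simp add: kappa_apply empty_in_Fpow singleton_eq_0)
  fix \<A> assume \<A>: "\<A> \<in> Fpow (Fpow X)"
  then have "finite \<A>" "\<A> \<subseteq> Fpow X" by (auto simp: Fpow_def)
  then have "\<delta> (insert x (\<Union>\<A>)) \<le> sum (kappa X \<delta> x) \<A>"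
  proof (induction \<A> rule: finite_induct)
    case empty
    then show ?case using x by (simp add: singleton_eq_0)
  next
    case (insert A \<A>)
    have "\<A> \<in> Fpow (Fpow X)" using insert by (simp add: Fpow_def)
    then have "\<delta> (insert x (A \<union> \<Union>\<A>)) \<le> \<delta> (insert x A) + \<delta> (insert x (\<Union>\<A>))"
      using insert.prems x by (intro join Union_in_Fpow) auto
    then show ?case using insert by (simp add: kappa_apply)
  qed
  then show "\<delta> (\<Union>\<A>) \<le> sum (kappa X \<delta> x) \<A>"
    using insert_mono[OF Union_in_Fpow[OF \<A>] x] by simp
qed

text \<open>
  A competitor \<open>g\<close> below \<open>kappa X \<delta> x\<close> vanishes at \<open>{x}\<close>, so \<open>\<delta> (A \<union> {x}) \<le> g A + g {x}\<close>
  leaves \<open>g A\<close> no room.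
\<close>

lemma kappa_in_tight_span:
  assumes x: "x \<in> X"
  shows "kappa X \<delta> x \<in> tight_span X \<delta>"
  unfolding tight_span_def
proof (safe intro!: kappa_in_diversity_P x)
  fix g assume g: "g \<in> diversity_P X \<delta>" and le: "\<forall>A\<in>Fpow X. g A \<le> kappa X \<delta> x A"
  have x1: "{x} \<in> Fpow X" using x by (simp add: Fpow_def)
  have "g {x} \<le> 0" using le x1 x by (auto simp: kappa_apply singleton_eq_0)
  show "g = kappa X \<delta> x"
  proof (rule extensionalityI[where A = "Fpow X"])
    show "g \<in> extensional (Fpow X)" using g by (simp add: diversity_P_def)
    show "kappa X \<delta> x \<in> extensional (Fpow X)" by (simp add: kappa_def)
    fix A assume A: "A \<in> Fpow X"
    have "kappa X \<delta> x A \<le> g A"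
      using diversity_P_Un[OF g A x1] \<open>g {x} \<le> 0\<close> by (simp add: kappa_apply A)
    then show "g A = kappa X \<delta> x A" using le A by (simp add: antisym)
  qed
qed

lemma kappa_image_in_Fpow: "Y \<in> Fpow X \<Longrightarrow> kappa X \<delta> ` Y \<in> Fpow (tight_span X \<delta>)"
  by (auto simp: Fpow_def intro!: kappa_in_tight_span)

lemma inj_on_kappa: "inj_on (kappa X \<delta>) X"
proof (rule inj_onI)
  fix x y assume xy: "x \<in> X" "y \<in> X" "kappa X \<delta> x = kappa X \<delta> y"
  have y: "{y} \<in> Fpow X" using xy by (simp add: Fpow_def)
  have "\<delta> {x, y} = kappa X \<delta> x {y}" by (simp add: kappa_apply y)
  also have "\<dots> = 0" using xy by (simp add: kappa_apply y singleton_eq_0)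
  finally have "card {x, y} \<le> 1" using eq_0_iff[of "{x, y}"] xy by (simp add: Fpow_def)
  then show "x = y" by (auto simp: card_insert_if split: if_splits)
qed

text \<open>
  The value of \<open>kappa X \<delta> y\<close> at \<open>A\<close> is the price of attaching \<open>A\<close> at the point \<open>y\<close>.  The set \<open>Z\<close>
  is carried along to make room for the sets that are paired with functions other than the
  \<open>kappa X \<delta> y\<close>.
\<close>

lemma kappa_cover_bound:
  assumes Y: "Y \<in> Fpow X" and Z: "Z \<in> Fpow X"
    and "finite S" "S \<subseteq> kappa X \<delta> ` Y \<times> Fpow X"
  shows "\<delta> (Y \<union> Z \<union> cover S) \<le> \<delta> (Y \<union> Z) + cost S"
  using assms(3,4)
proof (induction S rule: finite_induct)
  case (insert p S)
  obtain y A where p: "p = (kappa X \<delta> y, A)" and y: "y \<in> Y" and A: "A \<in> Fpow X"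
    using insert.prems by auto
  have yX: "y \<in> X" using y Y by (auto simp: Fpow_def)
  have "S \<in> Fpow (kappa X \<delta> ` Y \<times> Fpow X)" using insert by (simp add: Fpow_def)
  then have YZ: "Y \<union> Z \<union> cover S \<in> Fpow X" by (intro Un_in_Fpow Y Z cover_in_Fpow)
  have "Y \<union> Z \<union> cover (insert p S) = insert y ((Y \<union> Z \<union> cover S) \<union> A)" using y p by auto
  also have "\<delta> \<dots> \<le> \<delta> (insert y (Y \<union> Z \<union> cover S)) + \<delta> (insert y A)"
    by (rule join[OF YZ A yX])
  also have "insert y (Y \<union> Z \<union> cover S) = Y \<union> Z \<union> cover S" using y by auto
  finally show ?case
    using insert p A by (simp add: cost_insert kappa_apply)
qed simp

text \<open>
  From below, \<open>Y\<close> is covered free of charge by the pairs \<open>(kappa X \<delta> y, {y})\<close>.  From above, the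
  sets paired with \<open>f\<close> are paid for by \<open>f \<in> diversity_P X \<delta>\<close>, and all the others attach to \<open>Y\<close>.
\<close>

theorem tight_span_div_kappa:
  assumes Y: "Y \<in> Fpow X" and f: "f \<in> tight_span X \<delta>"
  shows "tight_span_div X \<delta> (kappa X \<delta> ` Y \<union> {f}) = f Y"
proof (rule antisym)
  define S where "S = (\<lambda>y. (kappa X \<delta> y, {y})) ` Y"
  have S: "S \<in> Fpow (kappa X \<delta> ` Y \<times> Fpow X)" using Y by (auto simp: S_def Fpow_def)
  have "cost S = 0"
    unfolding cost_def S_def using Y
    by (intro sum.neutral) (auto simp: kappa_apply Fpow_def singleton_eq_0 subset_iff)
  moreover have "cover S = Y" by (auto simp: cover_def S_def)
  ultimately show "f Y \<le> tight_span_div X \<delta> (kappa X \<delta> ` Y \<union> {f})"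
    using tight_span_div_insert_lower[OF kappa_image_in_Fpow[OF Y] f S] by simp
next
  have fP: "f \<in> diversity_P X \<delta>" using f by (rule tight_span_in_P)
  show "tight_span_div X \<delta> (kappa X \<delta> ` Y \<union> {f}) \<le> f Y"
  proof (rule tight_span_div_upper)
    show "kappa X \<delta> ` Y \<union> {f} \<in> Fpow (tight_span X \<delta>)"
      using f kappa_image_in_Fpow[OF Y] by (auto simp: Fpow_def)
    fix S assume S: "S \<in> Fpow ((kappa X \<delta> ` Y \<union> {f}) \<times> Fpow X)"
    define \<A> where "\<A> = {A. (f, A) \<in> S}"
    define S' where "S' = S - Pair f ` \<A>"
    have S_eq: "S = S' \<union> Pair f ` \<A>" by (auto simp: \<A>_def S'_def)
    have fin: "finite S" using S by (simp add: Fpow_def)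
    have "\<A> \<subseteq> snd ` S" by (force simp: \<A>_def)
    then have "finite \<A>" using fin by (metis finite_imageI finite_subset)
    then have \<A>: "\<A> \<in> Fpow (Fpow X)" using S by (auto simp: Fpow_def \<A>_def)
    have S': "finite S'" "S' \<subseteq> kappa X \<delta> ` Y \<times> Fpow X"
      using S by (auto simp: Fpow_def \<A>_def S'_def)
    \<comment> \<open>Enlarging the cover by \<open>Y\<close> supplies the points at which the pairs of \<open>S'\<close> attach.\<close>
    have U: "Y \<union> \<Union>\<A> \<union> cover S' \<in> Fpow X"
      using S' by (intro Un_in_Fpow Y Union_in_Fpow \<A> cover_in_Fpow) (auto simp: Fpow_def)
    have "cover S = \<Union>\<A> \<union> cover S'" by (subst S_eq) (auto simp: cover_Pair_image)
    then have "\<delta> (cover S) \<le> \<delta> (Y \<union> \<Union>\<A> \<union> cover S')" by (intro mono U) auto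
    also have "\<dots> \<le> \<delta> (Y \<union> \<Union>\<A>) + cost S'"
      by (rule kappa_cover_bound[OF Y Union_in_Fpow[OF \<A>] S'])
    also have "\<dots> \<le> f Y + (\<Sum>A\<in>\<A>. f A) + cost S'"
      using diversity_P_Un_Union[OF fP Y \<A>] by simp
    also have "(\<Sum>A\<in>\<A>. f A) = cost (Pair f ` \<A>)" by (simp add: cost_Pair_image)
    also have "f Y + cost (Pair f ` \<A>) + cost S' = f Y + cost S"
    proof -
      have "cost S = cost S' + cost (Pair f ` \<A>)"
        unfolding cost_def using fin \<open>finite \<A>\<close>
        by (subst S_eq, subst sum.union_disjoint) (auto simp: S'_def)
      then show ?thesis by simp
    qed
    finally show "\<delta> (cover S) \<le> f Y + cost S" .
  qed simp
qed

theorem kappa_embedding: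
  "diversity_embedding X \<delta> (tight_span X \<delta>) (tight_span_div X \<delta>) (kappa X \<delta>)"
  unfolding diversity_embedding_def
proof (intro conjI ballI diversity_tight_span inj_on_kappa)
  show "diversity X \<delta>" by unfold_locales
  show "kappa X \<delta> ` X \<subseteq> tight_span X \<delta>" using kappa_in_tight_span by auto
  fix A assume A: "A \<in> Fpow X"
  show "\<delta> A = tight_span_div X \<delta> (kappa X \<delta> ` A)"
  proof (cases "A = {}")
    case True
    then show ?thesis by (simp add: empty_eq_0 tight_span_div_def)
  next
    case False
    then obtain a where a: "a \<in> A" by auto
    then have "a \<in> X" using A by (auto simp: Fpow_def)
    then have "tight_span_div X \<delta> (kappa X \<delta> ` A \<union> {kappa X \<delta> a}) = kappa X \<delta> a A"
      by (intro tight_span_div_kappa A kappa_in_tight_span)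
    then show ?thesis using a A by (simp add: kappa_apply insert_absorb)
  qed
qed

section \<open>Minimality of the diversity on the tight span\<close>

text \<open>
  By assumption \<open>f A\<close> is the \<open>\<delta>'\<close>-price of attaching
  \<open>kappa X \<delta> ` A\<close> at the point \<open>f\<close>, so \<open>F\<close> can be enlarged by the image of \<open>cover S\<close> at total
  price \<open>cost S\<close>.
\<close>

theorem tight_span_div_least:
  assumes "diversity (tight_span X \<delta>) \<delta>'"
    and ext: "\<And>Y f. Y \<in> Fpow X \<Longrightarrow> f \<in> tight_span X \<delta> \<Longrightarrow> \<delta>' (kappa X \<delta> ` Y \<union> {f}) = f Y"
    and F: "F \<in> Fpow (tight_span X \<delta>)"
  shows "tight_span_div X \<delta> F \<le> \<delta>' F"
proof -
  interpret T: diversity "tight_span X \<delta>" \<delta>' by fact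
  show ?thesis
  proof (cases "F = {}")
    case True
    then show ?thesis by (simp add: tight_span_div_def T.empty_eq_0)
  next
    case False
    have kappa_eq: "\<delta>' (kappa X \<delta> ` U) = \<delta> U" if U: "U \<in> Fpow X" for U
    proof (cases "U = {}")
      case True
      then show ?thesis by (simp add: empty_eq_0 T.empty_eq_0)
    next
      case False
      then obtain x where x: "x \<in> U" by auto
      then have "x \<in> X" using U by (auto simp: Fpow_def)
      then show ?thesis
        using ext[OF U kappa_in_tight_span[of x]] x U by (simp add: kappa_apply insert_absorb)
    qed
    have attach: "\<delta>' (F \<union> kappa X \<delta> ` cover S) \<le> \<delta>' F + cost S"
      if "finite S" "S \<subseteq> F \<times> Fpow X" for S
      using that
    proof (induction S rule: finite_induct)
      case (insert p S)
      obtain f A where p: "p = (f, A)" and fF: "f \<in> F" and A: "A \<in> Fpow X"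
        using insert.prems by auto
      have f: "f \<in> tight_span X \<delta>" using F fF by (auto simp: Fpow_def)
      have "S \<in> Fpow (F \<times> Fpow X)" using insert by (simp add: Fpow_def)
      then have U: "F \<union> kappa X \<delta> ` cover S \<in> Fpow (tight_span X \<delta>)"
        by (intro Un_in_Fpow F kappa_image_in_Fpow cover_in_Fpow)
      have "F \<union> kappa X \<delta> ` cover (insert p S)
          = insert f ((F \<union> kappa X \<delta> ` cover S) \<union> kappa X \<delta> ` A)"
        using p fF by auto
      also have "\<delta>' \<dots> \<le> \<delta>' (insert f (F \<union> kappa X \<delta> ` cover S)) + \<delta>' (insert f (kappa X \<delta> ` A))"
        by (rule T.join[OF U kappa_image_in_Fpow[OF A] f])
      also have "insert f (F \<union> kappa X \<delta> ` cover S) = F \<union> kappa X \<delta> ` cover S" using fF by auto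
      also have "\<delta>' (insert f (kappa X \<delta> ` A)) = f A" using ext[OF A f] by simp
      finally show ?case using insert p by (simp add: cost_insert)
    qed simp
    show ?thesis
    proof (rule tight_span_div_upper[OF F False])
      fix S assume S: "S \<in> Fpow (F \<times> Fpow X)"
      have U: "cover S \<in> Fpow X" by (rule cover_in_Fpow[OF S])
      have "\<delta> (cover S) = \<delta>' (kappa X \<delta> ` cover S)" by (simp add: kappa_eq[OF U])
      also have "\<dots> \<le> \<delta>' (F \<union> kappa X \<delta> ` cover S)"
        by (intro T.mono Un_in_Fpow F kappa_image_in_Fpow U) auto
      also have "\<dots> \<le> \<delta>' F + cost S" using S by (intro attach) (auto simp: Fpow_def)
      finally show "\<delta> (cover S) \<le> \<delta>' F + cost S" .
    qed
  qed
qed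

end

theorem theorem2p8:
  fixes X :: "'a set" and \<delta> :: "'a set \<Rightarrow> real"
  assumes "diversity X \<delta>"
  shows "diversity_embedding X \<delta> (tight_span X \<delta>) (tight_span_div X \<delta>) (kappa X \<delta>) \<and>
    (\<forall>Y\<in>Fpow X. \<forall>f\<in>tight_span X \<delta>. tight_span_div X \<delta> (kappa X \<delta> ` Y \<union> {f}) = f Y) \<and>
    (\<forall>\<delta>'. diversity (tight_span X \<delta>) \<delta>' \<and>
          (\<forall>Y\<in>Fpow X. \<forall>f\<in>tight_span X \<delta>. \<delta>' (kappa X \<delta> ` Y \<union> {f}) = f Y) \<longrightarrow>
          (\<forall>F\<in>Fpow (tight_span X \<delta>). \<delta>' F \<ge> tight_span_div X \<delta> F))"
proof -
  interpret diversity X \<delta> by fact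
  show ?thesis
    using kappa_embedding tight_span_div_kappa tight_span_div_least by simp
qed

end
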